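(* Let $\mathcal{X}\subseteq\mathbb{R}^n$ be non-empty, convex and compact, and let $F:\mathcal{X}\to\mathbb{R}^n$ be Lipschitz continuous on $\mathcal{X}$ with constant $L$. Suppose Condition (GP* ) (defined in the context) holds with some $\delta>0$ and $t>0$. Let $x^1\in\mathcal{X}$ and let $\{x^k\}_{k\ge1}$ be generated by the gradient projection method $x^{k+1}=M(x^k;t)$ with this same $t$. Then the gradient projection method is convergent for the variational inequality problem defined by $F$ and $\mathcal{X}$ in terms of the merit functions $P$ and $G$, with the rates, as $N\to\infty$, $$\min_{1\le k\le N}P(x^k)=\mathcal{O}(1/N),\qquad\min_{1\le k\le N}G(x^k)=\mathcal{O}(1/N^{1/2}).$$
   Context: $\mathrm{Sol}$ denotes the set of $x^*\in\mathcal{X}$ with $\langle F(x^* ),x-x^*\rangle\ge0$ for all $x\in\mathcal{X}$. Gradient projection mapping: $M(x;t):=\mathrm{Proj}_{\mathcal{X}}(x-tF(x))$, with Euclidean projection onto $\mathcal{X}$. Equivalently, $M(x;t)=\arg\min_{y\in\mathcal{X}}\langle F(x),y-x\rangle+\frac{1}{2t}\|y-x\|^2$. Merit functions: $P(x):=\|M(x;t)-x\|^2$ and $G(x):=\max_{y\in\mathcal{X}}\langle F(x),x-y\rangle$. Condition (GP* ), with parameters $\delta>0$, $t>0$: for every $x\in\mathcal{X}$ there is $x^*\in\mathrm{Sol}$ such that, for the whole sequence $z_0=x$, $z_{j+1}=M(z_j;t)$ ($j\ge0$), one has $$2(1+\delta)t\,\langle F(z_j),M(z_j;t)-x^*\rangle+\|M(z_j;t)-z_j\|^2\ge0\quad\text{for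 all }j\ge0.$$ $\mathcal{O}(\cdot)$ means bounded by a constant independent of $N$ times the given quantity. *)

theory Defs
  imports "HOL-Analysis.Analysis" "HOL-Library.Landau_Symbols"
begin

definition VI_Sol :: "(real^'n) set \<Rightarrow> (real^'n \<Rightarrow> real^'n) \<Rightarrow> (real^'n) set" where
  "VI_Sol X F = {xs \<in> X. \<forall>x\<in>X. F xs \<bullet> (x - xs) \<ge> 0}"

text \<open>For a non-empty closed convex set, \<^const>\<open>closest_point\<close> is the Euclidean projection.\<close>

definition grad_proj ::
    "(real^'n) set \<Rightarrow> (real^'n \<Rightarrow> real^'n) \<Rightarrow> real \<Rightarrow> real^'n \<Rightarrow> real^'n" where
  "grad_proj X F t x = closest_point X (x - t *\<^sub>R F x)"

definition merit_P ::
    "(real^'n) set \<Rightarrow> (real^'n \<Rightarrow> real^'n) \<Rightarrow> real \<Rightarrow> real^'n \<Rightarrow> real" where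
  "merit_P X F t x = (norm (grad_proj X F t x - x))\<^sup>2"

text \<open>The maximum over \<open>y \<in> X\<close> is written as a supremum; for non-empty compact \<open>X\<close> it is attained,
  the function of \<open>y\<close> being continuous.\<close>

definition merit_G ::
    "(real^'n) set \<Rightarrow> (real^'n \<Rightarrow> real^'n) \<Rightarrow> real^'n \<Rightarrow> real" where
  "merit_G X F x = (SUP y\<in>X. F x \<bullet> (x - y))"

text \<open>The point \<open>xs\<close> may depend on the start \<open>x\<close>, but not on the index \<open>j\<close>.
  The sequence \<open>z\<close> is determined by \<open>x\<close>.\<close>

definition cond_GP_star ::
    "(real^'n) set \<Rightarrow> (real^'n \<Rightarrow> real^'n) \<Rightarrow> real \<Rightarrow> real \<Rightarrow> bool" where
  "cond_GP_star X F \<delta> t \<longleftrightarrow>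
     (\<forall>x\<in>X. \<exists>xs\<in>VI_Sol X F. \<forall>z :: nat \<Rightarrow> real^'n.
        z 0 = x \<and> (\<forall>j. z (Suc j) = grad_proj X F t (z j)) \<longrightarrow>
        (\<forall>j. 2 * (1 + \<delta>) * t * (F (z j) \<bullet> (grad_proj X F t (z j) - xs))
              + (norm (grad_proj X F t (z j) - z j))\<^sup>2 \<ge> 0))"

end

theory Submission imports Defs begin

text \<open>
  Fix the solution \<open>xs\<close> that the condition provides for the start \<open>x 1\<close>. The variational
  characterisation of the projection, tested at \<open>xs\<close>, bounds the squared distance to \<open>xs\<close> after a
  step by the old squared distance, minus the squared step length, plus
  \<open>- 2 t \<langle>F z, M z - xs\<rangle>\<close>; the condition lets this last term eat up only the fraction
  \<open>1 / (1 + \<delta>)\<close> of the squared step length. So the squared distance to \<open>xs\<close> drops by at least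
  \<open>\<delta> / (1 + \<delta>) * P\<close> in each step (\<open>grad_proj_step_descent\<close>). Telescoping shows that the values of
  \<open>P\<close> along the sequence are summable, which makes them tend to zero and bounds their running
  minimum by their average, that is, by a constant over \<open>N\<close>.

  The rate for \<open>G\<close> is the square root of the rate for \<open>P\<close>, because \<open>G\<close> is at most a constant
  multiple of the step length on a bounded set on which \<open>F\<close> is bounded
  (\<open>merit_G_le_step_length\<close>). This follows from the same variational characterisation, tested
  at arbitrary points of \<open>X\<close>.
\<close>

section \<open>One step of the gradient projection method\<close>

lemma grad_proj_in_set:
  assumes "X \<noteq> {}" "closed X"
  shows "grad_proj X F t x \<in> X"
  unfolding grad_proj_def using assms by (simp add: closest_point_in_set)

lemma grad_proj_variational:
  assumes "convex X" "closed X" "y \<in> X"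
  shows "(x - grad_proj X F t x) \<bullet> (y - grad_proj X F t x)
           \<le> t * (F x \<bullet> (y - grad_proj X F t x))"
  using closest_point_dot[OF assms, of "x - t *\<^sub>R F x"]
  unfolding grad_proj_def by (simp add: inner_diff_left)

text \<open>
  Write \<open>z'\<close> for the next iterate. The law of cosines
  \<open>\<bar>z' - xs\<bar>\<^sup>2 = \<bar>z - xs\<bar>\<^sup>2 - \<bar>z' - z\<bar>\<^sup>2 + 2 \<langle>z - z', xs - z'\<rangle>\<close> reduces the claim to an upper bound
  for the last term. The variational inequality bounds it by \<open>- 2 t \<langle>F z, z' - xs\<rangle>\<close>, and this is
  the quantity that hypothesis \<open>gp\<close> limits to \<open>P / (1 + \<delta>)\<close>.
\<close>

lemma grad_proj_step_descent:
  fixes X :: "(real^'n) set"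
  assumes "convex X" "closed X" "xs \<in> X" "\<delta> > 0"
    and gp: "2 * (1 + \<delta>) * t * (F z \<bullet> (grad_proj X F t z - xs)) + merit_P X F t z \<ge> 0"
  shows "(norm (grad_proj X F t z - xs))\<^sup>2
           \<le> (norm (z - xs))\<^sup>2 - \<delta> / (1 + \<delta>) * merit_P X F t z"
proof -
  define z' where "z' = grad_proj X F t z"
  define P where "P = merit_P X F t z"
  have P: "P = (norm (z' - z))\<^sup>2"
    unfolding P_def merit_P_def z'_def ..
  have vi: "(z - z') \<bullet> (xs - z') \<le> t * (F z \<bullet> (xs - z'))"
    unfolding z'_def using grad_proj_variational assms(1-3) .
  have flip: "t * (F z \<bullet> (xs - z')) = - (t * (F z \<bullet> (z' - xs)))"
    by (simp add: inner_diff_right algebra_simps)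
  have "(1 + \<delta>) * (- 2 * (t * (F z \<bullet> (z' - xs)))) \<le> P"
    using gp unfolding P_def[symmetric] z'_def[symmetric] by (simp add: algebra_simps)
  then have "- 2 * (t * (F z \<bullet> (z' - xs))) \<le> P / (1 + \<delta>)"
    using \<open>\<delta> > 0\<close> by (simp add: pos_le_divide_eq mult.commute)
  moreover have "(norm (z' - xs))\<^sup>2 = (norm (z - xs))\<^sup>2 - P + 2 * ((z - z') \<bullet> (xs - z'))"
    unfolding P power2_norm_eq_inner
    by (simp add: inner_diff_left inner_diff_right inner_commute algebra_simps)
  ultimately have "(norm (z' - xs))\<^sup>2 \<le> (norm (z - xs))\<^sup>2 - P + P / (1 + \<delta>)"
    using vi flip by linarith
  also have "\<dots> = (norm (z - xs))\<^sup>2 - \<delta> / (1 + \<delta>) * P"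
    using \<open>\<delta> > 0\<close> by (simp add: field_simps)
  finally show ?thesis
    unfolding z'_def P_def .
qed

section \<open>Comparison of the two merit functions\<close>

lemma merit_G_nonneg:
  fixes X :: "(real^'n) set"
  assumes "bounded X" "x \<in> X"
  shows "merit_G X F x \<ge> 0"
proof -
  have "F x \<bullet> (x - y) \<le> norm (F x) * diameter X" if "y \<in> X" for y
    using norm_cauchy_schwarz[of "F x" "x - y"]
      mult_left_mono[OF diameter_bounded_bound[OF assms(1,2) that], of "norm (F x)"]
    by (simp add: dist_norm)
  then have "bdd_above ((\<lambda>y. F x \<bullet> (x - y)) ` X)"
    by (intro bdd_aboveI2)
  then have "F x \<bullet> (x - x) \<le> merit_G X F x"
    unfolding merit_G_def using assms(2)
    by (intro cSUP_upper)
  then show ?thesis by simp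
qed

text \<open>
  Split \<open>\<langle>F x, x - y\<rangle>\<close> at the projected point \<open>x'\<close>: the part \<open>\<langle>F x, x - x'\<rangle>\<close> is at most
  \<open>B\<close> times the step length, and the variational inequality bounds \<open>t \<langle>F x, x' - y\<rangle>\<close> by
  \<open>\<langle>x - x', x' - y\<rangle>\<close>, hence by the step length times the diameter.
\<close>

lemma merit_G_le_step_length:
  fixes X :: "(real^'n) set"
  assumes "convex X" "closed X" "bounded X" "x \<in> X" "t > 0" and B: "norm (F x) \<le> B"
  shows "merit_G X F x \<le> (B + diameter X / t) * sqrt (merit_P X F t x)"
  unfolding merit_G_def
proof (rule cSUP_least)
  show "X \<noteq> {}" using \<open>x \<in> X\<close> by blast
next
  fix y assume "y \<in> X"
  define x' where "x' = grad_proj X F t x"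
  define s where "s = norm (x - x')"
  have s: "sqrt (merit_P X F t x) = s"
    unfolding merit_P_def s_def x'_def by (simp add: norm_minus_commute)
  have "x' \<in> X"
    unfolding x'_def using grad_proj_in_set \<open>x \<in> X\<close> \<open>closed X\<close> by blast
  then have diam: "norm (x' - y) \<le> diameter X"
    using diameter_bounded_bound[OF \<open>bounded X\<close>] \<open>y \<in> X\<close> by (simp add: dist_norm)
  have "(x - x') \<bullet> (y - x') \<le> t * (F x \<bullet> (y - x'))"
    unfolding x'_def using grad_proj_variational assms(1,2) \<open>y \<in> X\<close> .
  then have "t * (F x \<bullet> (x' - y)) \<le> (x - x') \<bullet> (x' - y)"
    by (simp add: inner_diff_right algebra_simps)
  also have "\<dots> \<le> s * norm (x' - y)"
    unfolding s_def by (rule norm_cauchy_schwarz)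
  also have "\<dots> \<le> s * diameter X"
    using diam by (simp add: s_def mult_left_mono)
  finally have "F x \<bullet> (x' - y) \<le> diameter X / t * s"
    using \<open>t > 0\<close> by (simp add: field_simps)
  moreover have "F x \<bullet> (x - x') \<le> B * s"
    using norm_cauchy_schwarz[of "F x" "x - x'"] mult_right_mono[OF B, of s]
    unfolding s_def by simp
  moreover have "F x \<bullet> (x - y) = F x \<bullet> (x - x') + F x \<bullet> (x' - y)"
    by (simp add: inner_diff_right)
  ultimately show "F x \<bullet> (x - y) \<le> (B + diameter X / t) * sqrt (merit_P X F t x)"
    unfolding s by (simp add: distrib_right)
qed

section \<open>Running minima\<close>

lemma Min_le_average:
  fixes f :: "nat \<Rightarrow> real"
  assumes "N \<ge> 1" and "(\<Sum>k=1..N. f k) \<le> C"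
  shows "Min (f ` {1..N}) \<le> C / real N"
proof -
  have "real N * Min (f ` {1..N}) \<le> (\<Sum>k=1..N. f k)"
    using sum_bounded_below[of "{1..N}" "Min (f ` {1..N})" f] by simp
  then show ?thesis
    using assms by (simp add: field_simps)
qed

lemma Min_le_mult_sqrt_Min:
  fixes f g :: "nat \<Rightarrow> real"
  assumes "N \<ge> 1" and "\<And>k. k \<ge> 1 \<Longrightarrow> g k \<le> c * sqrt (f k)"
  shows "Min (g ` {1..N}) \<le> c * sqrt (Min (f ` {1..N}))"
proof -
  have "Min (f ` {1..N}) \<in> f ` {1..N}"
    using assms(1) by (intro Min_in) auto
  then obtain k where k: "k \<in> {1..N}" "Min (f ` {1..N}) = f k"
    by blast
  have "Min (g ` {1..N}) \<le> g k"
    using k(1) by simp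
  also have "\<dots> \<le> c * sqrt (f k)"
    using assms(2) k(1) by simp
  finally show ?thesis using k(2) by simp
qed

lemma Min_image_nonneg:
  fixes f :: "nat \<Rightarrow> real"
  assumes "N \<ge> 1" and "\<And>k. k \<ge> 1 \<Longrightarrow> f k \<ge> 0"
  shows "Min (f ` {1..N}) \<ge> 0"
  using assms by (subst Min_ge_iff) auto

section \<open>Convergence and rates\<close>

theorem theorem3p14:
  fixes X :: "(real^'n) set" and F :: "real^'n \<Rightarrow> real^'n"
    and L \<delta> t :: real and x :: "nat \<Rightarrow> real^'n"
  assumes "X \<noteq> {}" and "convex X" and "compact X"
    and "L-lipschitz_on X F"
    and "\<delta> > 0" and "t > 0"
    and "cond_GP_star X F \<delta> t"
    and "x 1 \<in> X"
    and "\<And>k. k \<ge> 1 \<Longrightarrow> x (Suc k) = grad_proj X F t (x k)"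
  shows "(\<lambda>k. merit_P X F t (x k)) \<longlonglongrightarrow> 0 \<and>
    (\<lambda>k. merit_G X F (x k)) \<longlonglongrightarrow> 0 \<and>
    (\<lambda>N. Min ((\<lambda>k. merit_P X F t (x k)) ` {1..N})) \<in> O(\<lambda>N. 1 / real N) \<and>
    (\<lambda>N. Min ((\<lambda>k. merit_G X F (x k)) ` {1..N})) \<in> O(\<lambda>N. 1 / real N powr (1/2))"
proof -
  define P where "P k = merit_P X F t (x k)" for k
  define G where "G k = merit_G X F (x k)" for k
  have closed: "closed X" and bounded: "bounded X"
    using \<open>compact X\<close> by (auto simp: compact_imp_closed compact_imp_bounded)
  have xX: "x k \<in> X" if "k \<ge> 1" for k
    using that
  proof (induction k rule: dec_induct)
    case base
    then show ?case using \<open>x 1 \<in> X\<close> by simp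
  next
    case (step k)
    then show ?case using assms(9) grad_proj_in_set[OF \<open>X \<noteq> {}\<close> closed] by simp
  qed
  have P0: "P k \<ge> 0" for k
    unfolding P_def merit_P_def by simp
  have G0: "G k \<ge> 0" if "k \<ge> 1" for k
    unfolding G_def using merit_G_nonneg[OF bounded xX[OF that]] .

  obtain xs where xs: "xs \<in> VI_Sol X F" and
    "\<And>z j. z 0 = x 1 \<and> (\<forall>j. z (Suc j) = grad_proj X F t (z j)) \<Longrightarrow>
       2 * (1 + \<delta>) * t * (F (z j) \<bullet> (grad_proj X F t (z j) - xs))
         + (norm (grad_proj X F t (z j) - z j))\<^sup>2 \<ge> 0"
    using assms(7,8) unfolding cond_GP_star_def by metis
  \<comment> \<open>The condition counts iterates from \<open>0\<close>, the method from \<open>1\<close>.\<close>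
  from this(2)[of "\<lambda>j. x (Suc j)"]
  have gp: "2 * (1 + \<delta>) * t * (F (x (Suc j)) \<bullet> (grad_proj X F t (x (Suc j)) - xs))
      + merit_P X F t (x (Suc j)) \<ge> 0" for j
    using assms(9) unfolding merit_P_def by simp

  have "xs \<in> X"
    using xs unfolding VI_Sol_def by simp
  define C where "C = (1 + \<delta>) / \<delta> * (norm (x 1 - xs))\<^sup>2"
  have "C \<ge> 0"
    using \<open>\<delta> > 0\<close> unfolding C_def by simp
  have descent: "(norm (x (Suc (Suc j)) - xs))\<^sup>2
      \<le> (norm (x (Suc j) - xs))\<^sup>2 - \<delta> / (1 + \<delta>) * P (Suc j)" for j
    using grad_proj_step_descent[OF \<open>convex X\<close> closed \<open>xs \<in> X\<close> \<open>\<delta> > 0\<close> gp] assms(9)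
    unfolding P_def by simp
  have "\<delta> / (1 + \<delta>) * (\<Sum>j<N. P (Suc j))
      \<le> (norm (x 1 - xs))\<^sup>2 - (norm (x (Suc N) - xs))\<^sup>2" for N
  proof (induction N)
    case (Suc N)
    then show ?case using descent[of N] by (simp add: distrib_left)
  qed simp
  then have "\<delta> / (1 + \<delta>) * (\<Sum>j<N. P (Suc j)) \<le> (norm (x 1 - xs))\<^sup>2" for N
    by (smt (verit) zero_le_power2)
  then have sum_P: "(\<Sum>j<N. P (Suc j)) \<le> C" for N
    using \<open>\<delta> > 0\<close> unfolding C_def by (simp add: field_simps)

  have "summable (\<lambda>j. P (Suc j))"
    using P0 sum_P by (rule summableI_nonneg_bounded)
  then have P_lim: "P \<longlonglongrightarrow> 0"
    using summable_LIMSEQ_zero filterlim_sequentially_Suc by blast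
  have min_P: "Min (P ` {1..N}) \<le> C / real N" if "N \<ge> 1" for N
    using that sum_P[of N]
    by (intro Min_le_average) (simp_all add: sum.atLeast1_atMost_eq)

  have "compact (F ` X)"
    using \<open>L-lipschitz_on X F\<close> \<open>compact X\<close>
    by (intro compact_continuous_image lipschitz_on_continuous_on)
  then obtain B where B: "\<And>y. y \<in> X \<Longrightarrow> norm (F y) \<le> B"
    using compact_imp_bounded bounded_iff by (metis imageI)
  define c where "c = B + diameter X / t"
  have "B \<ge> 0"
    using B[OF \<open>x 1 \<in> X\<close>] norm_ge_zero order_trans by blast
  then have "c \<ge> 0"
    using \<open>t > 0\<close> diameter_ge_0[OF bounded] unfolding c_def by simp
  have G_le: "G k \<le> c * sqrt (P k)" if "k \<ge> 1" for k
    unfolding G_def P_def c_def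
    using \<open>convex X\<close> closed bounded xX[OF that] \<open>t > 0\<close> B[OF xX[OF that]]
    by (rule merit_G_le_step_length)
  have min_G: "Min (G ` {1..N}) \<le> c * sqrt C * (1 / real N powr (1/2))" if "N \<ge> 1" for N
  proof -
    have "Min (G ` {1..N}) \<le> c * sqrt (Min (P ` {1..N}))"
      using that G_le by (rule Min_le_mult_sqrt_Min)
    also have "\<dots> \<le> c * sqrt (C / real N)"
      using min_P[OF that] \<open>c \<ge> 0\<close> by (intro mult_left_mono real_sqrt_le_mono)
    also have "\<dots> = c * sqrt C * (1 / real N powr (1/2))"
      by (simp add: real_sqrt_divide powr_half_sqrt)
    finally show ?thesis .
  qed

  have "G \<longlonglongrightarrow> 0"
  proof (rule tendsto_sandwich)
    show "\<forall>\<^sub>F k in sequentially. 0 \<le> G k"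
      using eventually_ge_at_top[of 1] by eventually_elim (rule G0)
    show "\<forall>\<^sub>F k in sequentially. G k \<le> c * sqrt (P k)"
      using eventually_ge_at_top[of 1] by eventually_elim (rule G_le)
    show "(\<lambda>k. c * sqrt (P k)) \<longlonglongrightarrow> 0"
      using tendsto_mult_left[OF tendsto_real_sqrt[OF P_lim], of c] by simp
  qed simp
  moreover have "(\<lambda>N. Min (P ` {1..N})) \<in> O(\<lambda>N. 1 / real N)"
  proof (rule bigoI[of _ C])
    show "\<forall>\<^sub>F N in sequentially. norm (Min (P ` {1..N})) \<le> C * norm (1 / real N)"
      using eventually_ge_at_top[of 1]
    proof eventually_elim
      case (elim N)
      show ?case using min_P[OF elim] Min_image_nonneg[OF elim, of P] P0 by simp
    qed
  qed
  moreover have "(\<lambda>N. Min (G ` {1..N})) \<in> O(\<lambda>N. 1 / real N powr (1/2))"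
  proof (rule bigoI[of _ "c * sqrt C"])
    show "\<forall>\<^sub>F N in sequentially.
        norm (Min (G ` {1..N})) \<le> c * sqrt C * norm (1 / real N powr (1/2))"
      using eventually_ge_at_top[of 1]
    proof eventually_elim
      case (elim N)
      show ?case using min_G[OF elim] Min_image_nonneg[OF elim, of G] G0 by simp
    qed
  qed
  ultimately show ?thesis
    using P_lim unfolding P_def[abs_def] G_def[abs_def] by (intro conjI)
qed

end
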